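(* Consider the online multiple knapsack problem with departures (defined in the context), and suppose that for every resource $k\in K$ the demand bound satisfies $\epsilon_k \le \frac{C_k\ln 2}{\gamma_k}$, where $\gamma_k = 2\ln(2+4\bar\theta_k\bar d_k)$. Then Algorithm 1 outputs a feasible (integral) solution, and it has a competitive ratio of $O\big(\log(\bar\theta^{\max}\cdot \bar d^{\max})\big)$, where $\bar\theta^{\max}=\max_{k\in K}\bar\theta_k$ and $\bar d^{\max}=\max_{k\in K}\bar d_k$.
   Context: Problem (online multiple knapsack with departures). There is a finite set $K$ of resources, resource $k$ having capacity $C_k>0$, a discrete time horizon $T$ of time slots, and a set $N$ of requests that arrive one at a time. For each request $n$ and resource $k$ there are a reward $v_{nk}\ge 0$, a demand (weight) $w_{nk}>0$, a start slot $s_{nk}$ and an integer duration $d_{nk}\ge 1$; let $T_{nk}=\{s_{nk},s_{nk}+1,\dots,s_{nk}+d_{nk}-1\}\subseteq T$. When request $n$ arrives, all the data $(v_{nk},w_{nk},s_{nk},d_{nk})_{k\in K}$ are revealed, and the online algorithm must immediately and irrevocably either reject $n$ or assign it to exactly one resource, without knowledge of future requests. A solution $x\in\{0,1\}^{N\times K}$ is feasible if $\sum_{k}x_{nk}\le 1$ for all $n$ and $\sum_{n\in N:\,t\in T_{nk}} w_{nk}x_{nk}\le C_k$ for all $k\in K$, $t\in T$; its value is $\sum_{n,k}v_{nk}x_{nk}$. Assumptions: (A1) the value density $\theta_{nk}=\frac{v_{nk}}{w_{nk}d_{nk}}$ of every request with $v_{nk}>0$ lies in $[\theta_k^{\min},\theta_k^{\max}]$,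 where $0<\theta_k^{\min}\le\theta_k^{\max}<\infty$ and $\theta_k^{\min}$ and $\bar\theta_k=\theta_k^{\max}/\theta_k^{\min}$ are known to the algorithm; (A2) $d_{nk}\in[d_k^{\min},d_k^{\max}]$ with $\bar d_k=d_k^{\max}/d_k^{\min}$ finite and known; (A3) $w_{nk}\le \epsilon_k\le C_k$ for all $n\in N$, $k\in K$. Parameters: $\gamma_k=2\ln(2+4\bar\theta_k\bar d_k)$, $\mu_{nk}=e^{w_{nk}\gamma_k/C_k}$, $\beta_{nk}=\theta_k^{\min}(\mu_{nk}-1)$. Algorithm 1: initialize $x=0$, prices $p_{kt}=0$ ($k\in K,t\in T$), and $u_n=0$ ($n\in N$). When request $n$ arrives, let $k^*\in\arg\max_{k\in K}\{v_{nk}-w_{nk}\sum_{t\in T_{nk}}p_{kt}\}$. If $v_{nk^*}>w_{nk^*}\sum_{t\in T_{nk^*}}p_{k^*t}$, set $x_{nk^*}=1$, $u_n=v_{nk^*}-w_{nk^*}\sum_{t\in T_{nk^*}}p_{k^*t}$, and for every $t\in T_{nk^*}$ update $p_{k^*t}\leftarrow \mu_{nk^*}p_{k^*t}+\beta_{nk^*}$; otherwise reject $n$ and change nothing. Competitive ratio: the algorithm has competitive ratio $\alpha$ if for every instance satisfying the assumptions, the optimal offline value (maximum value of a feasible integral solution knowing all requests in advance) is at most $\alpha$ times the value of the algorithm's solution. *)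

theory Defs
  imports Complex_Main "HOL-Library.Landau_Symbols"
begin

text \<open>
  Requests are numbered \<open>0, 1, \<dots>, num_requests - 1\<close> in their order of arrival. The last five
  fields are the bounds appearing in the assumptions.
\<close>

record 'k omkd =
  resources :: "'k set"
  capacity :: "'k \<Rightarrow> real"
  slots :: "nat set"
  num_requests :: nat
  reward :: "nat \<Rightarrow> 'k \<Rightarrow> real"
  demand :: "nat \<Rightarrow> 'k \<Rightarrow> real"
  start :: "nat \<Rightarrow> 'k \<Rightarrow> nat"
  duration :: "nat \<Rightarrow> 'k \<Rightarrow> nat"
  theta_min :: "'k \<Rightarrow> real"
  theta_max :: "'k \<Rightarrow> real"
  d_min :: "'k \<Rightarrow> real"
  d_max :: "'k \<Rightarrow> real"
  eps :: "'k \<Rightarrow> real"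

definition requests :: "'k omkd \<Rightarrow> nat set" where
  "requests I = {..<num_requests I}"

definition active :: "'k omkd \<Rightarrow> nat \<Rightarrow> 'k \<Rightarrow> nat set" where
  "active I n k = {start I n k..<start I n k + duration I n k}"

definition density :: "'k omkd \<Rightarrow> nat \<Rightarrow> 'k \<Rightarrow> real" where
  "density I n k = reward I n k / (demand I n k * real (duration I n k))"

definition theta_bar :: "'k omkd \<Rightarrow> 'k \<Rightarrow> real" where
  "theta_bar I k = theta_max I k / theta_min I k"

definition d_bar :: "'k omkd \<Rightarrow> 'k \<Rightarrow> real" where
  "d_bar I k = d_max I k / d_min I k"

definition theta_bar_max :: "'k omkd \<Rightarrow> real" where
  "theta_bar_max I = Max (theta_bar I ` resources I)"

definition d_bar_max :: "'k omkd \<Rightarrow> real" where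
  "d_bar_max I = Max (d_bar I ` resources I)"

definition well_formed :: "'k omkd \<Rightarrow> bool" where
  "well_formed I \<longleftrightarrow>
     finite (resources I) \<and> resources I \<noteq> {} \<and> finite (slots I) \<and>
     (\<forall>k\<in>resources I. 0 < capacity I k) \<and>
     (\<forall>n\<in>requests I. \<forall>k\<in>resources I.
        0 \<le> reward I n k \<and> 0 < demand I n k \<and> 1 \<le> duration I n k \<and> active I n k \<subseteq> slots I)"

definition density_assumption :: "'k omkd \<Rightarrow> bool" where
  "density_assumption I \<longleftrightarrow>
     (\<forall>k\<in>resources I. 0 < theta_min I k \<and> theta_min I k \<le> theta_max I k) \<and>
     (\<forall>n\<in>requests I. \<forall>k\<in>resources I.
        0 < reward I n k \<longrightarrow> density I n k \<in> {theta_min I k..theta_max I k})"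

definition duration_assumption :: "'k omkd \<Rightarrow> bool" where
  "duration_assumption I \<longleftrightarrow>
     (\<forall>k\<in>resources I. 0 < d_min I k \<and> d_min I k \<le> d_max I k) \<and>
     (\<forall>n\<in>requests I. \<forall>k\<in>resources I. real (duration I n k) \<in> {d_min I k..d_max I k})"

definition demand_assumption :: "'k omkd \<Rightarrow> bool" where
  "demand_assumption I \<longleftrightarrow>
     (\<forall>k\<in>resources I. eps I k \<le> capacity I k) \<and>
     (\<forall>n\<in>requests I. \<forall>k\<in>resources I. demand I n k \<le> eps I k)"

definition admissible :: "'k omkd \<Rightarrow> bool" where
  "admissible I \<longleftrightarrow>
     well_formed I \<and> density_assumption I \<and> duration_assumption I \<and> demand_assumption I"

definition feasible :: "'k omkd \<Rightarrow> (nat \<Rightarrow> 'k \<Rightarrow> real) \<Rightarrow> bool" where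
  "feasible I x \<longleftrightarrow>
     (\<forall>n\<in>requests I. \<forall>k\<in>resources I. x n k \<in> {0, 1}) \<and>
     (\<forall>n\<in>requests I. (\<Sum>k\<in>resources I. x n k) \<le> 1) \<and>
     (\<forall>k\<in>resources I. \<forall>t\<in>slots I.
        (\<Sum>n | n \<in> requests I \<and> t \<in> active I n k. demand I n k * x n k) \<le> capacity I k)"

definition sol_value :: "'k omkd \<Rightarrow> (nat \<Rightarrow> 'k \<Rightarrow> real) \<Rightarrow> real" where
  "sol_value I x = (\<Sum>n\<in>requests I. \<Sum>k\<in>resources I. reward I n k * x n k)"

definition opt_value :: "'k omkd \<Rightarrow> real" where
  "opt_value I = Max (sol_value I ` {x. feasible I x})"

definition gamma :: "'k omkd \<Rightarrow> 'k \<Rightarrow> real" where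
  "gamma I k = 2 * ln (2 + 4 * theta_bar I k * d_bar I k)"

definition mu :: "'k omkd \<Rightarrow> nat \<Rightarrow> 'k \<Rightarrow> real" where
  "mu I n k = exp (demand I n k * gamma I k / capacity I k)"

definition beta :: "'k omkd \<Rightarrow> nat \<Rightarrow> 'k \<Rightarrow> real" where
  "beta I n k = theta_min I k * (mu I n k - 1)"

record 'k alg_state =
  sol :: "nat \<Rightarrow> 'k \<Rightarrow> real"
  price :: "'k \<Rightarrow> nat \<Rightarrow> real"
  util :: "nat \<Rightarrow> real"

definition init_state :: "'k alg_state" where
  "init_state = \<lparr>sol = (\<lambda>n k. 0), price = (\<lambda>k t. 0), util = (\<lambda>n. 0)\<rparr>"

definition cost :: "'k omkd \<Rightarrow> 'k alg_state \<Rightarrow> nat \<Rightarrow> 'k \<Rightarrow> real" where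
  "cost I s n k = demand I n k * (\<Sum>t\<in>active I n k. price s k t)"

definition best_resource :: "'k omkd \<Rightarrow> 'k alg_state \<Rightarrow> nat \<Rightarrow> 'k \<Rightarrow> bool" where
  "best_resource I s n k \<longleftrightarrow>
     is_arg_max (\<lambda>j. reward I n j - cost I s n j) (\<lambda>j. j \<in> resources I) k"

definition assign :: "'k omkd \<Rightarrow> nat \<Rightarrow> 'k \<Rightarrow> 'k alg_state \<Rightarrow> 'k alg_state" where
  "assign I n k s =
     \<lparr>sol = (sol s)(n := (sol s n)(k := 1)),
      price = (price s)(k := (\<lambda>t. if t \<in> active I n k
                                  then mu I n k * price s k t + beta I n k
                                  else price s k t)),
      util = (util s)(n := reward I n k - cost I s n k)\<rparr>"

text \<open>
  The algorithm leaves open how ties in the arg max are broken, so a run is a relation: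
  \<open>alg_run I n s\<close> says that \<open>s\<close> is a possible state after the first \<open>n\<close> requests.
\<close>

inductive alg_step :: "'k omkd \<Rightarrow> nat \<Rightarrow> 'k alg_state \<Rightarrow> 'k alg_state \<Rightarrow> bool" for I n s where
  accept: "best_resource I s n k \<Longrightarrow> reward I n k > cost I s n k \<Longrightarrow>
             alg_step I n s (assign I n k s)"
| reject: "best_resource I s n k \<Longrightarrow> \<not> reward I n k > cost I s n k \<Longrightarrow>
             alg_step I n s s"

inductive alg_run :: "'k omkd \<Rightarrow> nat \<Rightarrow> 'k alg_state \<Rightarrow> bool" for I where
  init: "alg_run I 0 init_state"
| step: "alg_run I n s \<Longrightarrow> alg_step I n s s' \<Longrightarrow> alg_run I (Suc n) s'"

definition alg_output :: "'k omkd \<Rightarrow> (nat \<Rightarrow> 'k \<Rightarrow> real) \<Rightarrow> bool" where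
  "alg_output I x \<longleftrightarrow> (\<exists>s. alg_run I (num_requests I) s \<and> x = sol s)"

text \<open>
  The ratio \<open>\<alpha>\<close> may depend on the parameters of the instance; \<open>P\<close> is the class of instances considered.
\<close>

definition has_competitive_ratio :: "('k omkd \<Rightarrow> bool) \<Rightarrow> ('k omkd \<Rightarrow> real) \<Rightarrow> bool" where
  "has_competitive_ratio P \<alpha> \<longleftrightarrow>
     (\<forall>I x. P I \<longrightarrow> alg_output I x \<longrightarrow> opt_value I \<le> \<alpha> I * sol_value I x)"

definition small_demands :: "'k omkd \<Rightarrow> bool" where
  "small_demands I \<longleftrightarrow> (\<forall>k\<in>resources I. eps I k \<le> capacity I k * ln 2 / gamma I k)"

lemma best_resource_exists:
  assumes "well_formed I"
  shows "\<exists>k. best_resource I s n k"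
proof -
  let ?f = "\<lambda>j. reward I n j - cost I s n j"
  have fin: "finite (?f ` resources I)" and ne: "?f ` resources I \<noteq> {}"
    using assms by (auto simp: well_formed_def)
  obtain k where k: "k \<in> resources I" "?f k = Max (?f ` resources I)"
    using Max_in[OF fin ne] by (metis (no_types, lifting) imageE)
  have "?f j \<le> ?f k" if "j \<in> resources I" for j
    using Max_ge[OF fin, of "?f j"] that k(2) by auto
  then have "best_resource I s n k"
    using k(1) by (auto simp: best_resource_def is_arg_max_def not_less)
  then show ?thesis ..
qed

lemma alg_output_exists:
  assumes "well_formed I"
  shows "\<exists>x. alg_output I x"
proof -
  have "\<exists>s. alg_run I n s" for n
  proof (induction n)
    case 0
    show ?case by (blast intro: alg_run.init)
  next
    case (Suc n)
    then obtain s where s: "alg_run I n s" ..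
    obtain k where "best_resource I s n k"
      using best_resource_exists[OF assms] by blast
    then have "\<exists>s'. alg_step I n s s'"
      by (blast intro: alg_step.intros)
    with s show ?case by (blast intro: alg_run.step)
  qed
  then show ?thesis by (auto simp: alg_output_def)
qed

lemma feasible_zero:
  assumes "well_formed I"
  shows "feasible I (\<lambda>n k. 0)"
  using assms by (auto simp: feasible_def well_formed_def less_imp_le)

lemma finite_feasible_values:
  assumes "well_formed I"
  shows "finite (sol_value I ` {x. feasible I x})"
proof -
  let ?R = "requests I \<times> resources I"
  let ?g = "\<lambda>A. \<Sum>(n, k)\<in>?R. reward I n k * (if (n, k) \<in> A then 1 else 0)"
  have "finite ?R"
    using assms by (simp add: well_formed_def requests_def)
  moreover have "sol_value I ` {x. feasible I x} \<subseteq> ?g ` Pow ?R"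
  proof
    fix v assume "v \<in> sol_value I ` {x. feasible I x}"
    then obtain x where x: "feasible I x" and v: "v = sol_value I x" by auto
    have "v = (\<Sum>(n, k)\<in>?R. reward I n k * x n k)"
      by (simp add: v sol_value_def sum.cartesian_product)
    also have "\<dots> = ?g {(n, k) \<in> ?R. x n k = 1}"
      using x by (intro sum.cong) (force simp: feasible_def)+
    finally show "v \<in> ?g ` Pow ?R" by blast
  qed
  ultimately show ?thesis by (meson finite_Pow_iff finite_imageI finite_subset)
qed

end

theory Submission
  imports Defs
begin

text \<open>
  Prices are an exponential function of the load: a slot of resource \<open>k\<close> with load \<open>L\<close> has price
  \<open>theta_min * (exp (gamma * L / capacity) - 1)\<close>.

  Feasibility: suppose the accepted requests active at a slot \<open>t\<close> of \<open>k\<close> exceed the capacity. Each of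
  them has length at least \<open>d_min\<close>, so it covers the \<open>h = \<lceil>d_min / 2\<rceil>\<close> slots ending at \<open>t\<close> or
  the \<open>h\<close> slots starting at \<open>t\<close>; the requests of one of these kinds have total demand above half the
  capacity. When the last request of that kind arrived, all \<open>h\<close> slots of the window had load above
  \<open>capacity / 2 - eps\<close>, hence price at least \<open>2 * theta_max * d_bar\<close>, so its cost was at least
  \<open>demand * theta_max * d_max\<close>, which is no less than its reward; it should have been rejected.

  Competitiveness: the final prices together with the utilities are feasible for the dual linear
  program, and accepting a request of reward \<open>v\<close> on \<open>k\<close> raises the dual objective by at most
  \<open>(1 + 4 * gamma) * v\<close>.
\<close>

section \<open>Loads and the prices they determine\<close>

definition load :: "'k omkd \<Rightarrow> (nat \<Rightarrow> 'k \<Rightarrow> real) \<Rightarrow> nat \<Rightarrow> 'k \<Rightarrow> nat \<Rightarrow> real" where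
  "load I x n k t = (\<Sum>m | m < n \<and> t \<in> active I m k. demand I m k * x m k)"

text \<open>The count \<open>n\<close> is separate from \<open>x\<close>. Decisions are never
  revised, so the final solution with a smaller \<open>n\<close> still yields the prices that
  request \<open>n\<close> saw, and no history of states has to be kept.\<close>

definition load_price :: "'k omkd \<Rightarrow> (nat \<Rightarrow> 'k \<Rightarrow> real) \<Rightarrow> nat \<Rightarrow> 'k \<Rightarrow> nat \<Rightarrow> real" where
  "load_price I x n k t = theta_min I k * (exp (gamma I k * load I x n k t / capacity I k) - 1)"

text \<open>Objective of the dual of the LP relaxation: \<open>price\<close> belongs to the capacity
  constraints, \<open>util\<close> to the constraints allowing one resource per request.\<close>

definition dual_value :: "'k omkd \<Rightarrow> nat \<Rightarrow> 'k alg_state \<Rightarrow> real" where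
  "dual_value I n s =
     (\<Sum>k\<in>resources I. \<Sum>t\<in>slots I. capacity I k * price s k t) + (\<Sum>m<n. util s m)"

lemma load_cong:
  assumes "\<And>m. m < n \<Longrightarrow> x m k = y m k"
  shows "load I x n k t = load I y n k t"
  unfolding load_def using assms by (intro sum.cong) auto

lemma load_Suc:
  "load I x (Suc n) k t = load I x n k t + (if t \<in> active I n k then demand I n k * x n k else 0)"
proof -
  have "{m. m < Suc n \<and> t \<in> active I m k} =
      (if t \<in> active I n k then insert n {m. m < n \<and> t \<in> active I m k}
       else {m. m < n \<and> t \<in> active I m k})"
    by (auto simp: less_Suc_eq)
  then show ?thesis
    by (simp add: load_def)
qed

lemma exp_minus_one_le:
  assumes "0 \<le> (y::real)" "y \<le> 1"
  shows "exp y - 1 \<le> 2 * y"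
proof -
  have "y\<^sup>2 \<le> y"
    using assms by (simp add: power2_eq_square mult_left_le)
  with exp_bound[OF assms] show ?thesis by linarith
qed

section \<open>Bounds derived from the assumptions on the instance\<close>

locale small_demand_instance =
  fixes I :: "'k omkd"
  assumes adm: "admissible I" and small: "small_demands I"
begin

lemma finite_resources: "finite (resources I)"
  and finite_slots: "finite (slots I)"
  using adm by (auto simp: admissible_def well_formed_def)

lemma capacity_pos: "k \<in> resources I \<Longrightarrow> 0 < capacity I k"
  using adm by (auto simp: admissible_def well_formed_def)

lemma theta_min_pos: "k \<in> resources I \<Longrightarrow> 0 < theta_min I k"
  using adm by (auto simp: admissible_def density_assumption_def)

lemma d_min_pos: "k \<in> resources I \<Longrightarrow> 0 < d_min I k"
  using adm by (auto simp: admissible_def duration_assumption_def)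

lemma theta_bar_ge_1: "k \<in> resources I \<Longrightarrow> 1 \<le> theta_bar I k"
  using adm by (auto simp: admissible_def density_assumption_def theta_bar_def)

lemma d_bar_ge_1: "k \<in> resources I \<Longrightarrow> 1 \<le> d_bar I k"
  using adm by (auto simp: admissible_def duration_assumption_def d_bar_def)

lemma gamma_pos:
  assumes "k \<in> resources I"
  shows "0 < gamma I k"
proof -
  have "0 < theta_bar I k * d_bar I k"
    using theta_bar_ge_1[OF assms] d_bar_ge_1[OF assms] by (intro mult_pos_pos) auto
  then show ?thesis by (simp add: gamma_def mult.assoc)
qed

text \<open>This value motivates \<open>gamma\<close>: it is the exponential at half load. Halving
  it for one missing request and subtracting 1 leaves exactly
  \<open>2 * theta_bar * d_bar\<close>.\<close>

lemma exp_half_gamma: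
  assumes "k \<in> resources I"
  shows "exp (gamma I k / 2) = 2 + 4 * theta_bar I k * d_bar I k"
proof -
  have "0 < theta_bar I k * d_bar I k"
    using theta_bar_ge_1[OF assms] d_bar_ge_1[OF assms] by (intro mult_pos_pos) auto
  then show ?thesis by (simp add: gamma_def mult.assoc)
qed

context
  fixes n k
  assumes n: "n < num_requests I" and k: "k \<in> resources I"
begin

lemma reward_nonneg: "0 \<le> reward I n k"
  and demand_pos: "0 < demand I n k"
  and duration_pos: "1 \<le> duration I n k"
  and active_slots: "active I n k \<subseteq> slots I"
  using adm n k by (auto simp: admissible_def well_formed_def requests_def)

lemma d_min_le_duration: "d_min I k \<le> real (duration I n k)"
  and duration_le_d_max: "real (duration I n k) \<le> d_max I k"
  using adm n k by (auto simp: admissible_def duration_assumption_def requests_def)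

text \<open>Says that \<open>mu\<close> is at most 2: leaving one request out of a load at most
  halves the exponential.\<close>

lemma demand_gamma_le: "demand I n k * gamma I k / capacity I k \<le> ln 2"
proof -
  have "demand I n k \<le> eps I k"
    using adm n k by (auto simp: admissible_def demand_assumption_def requests_def)
  also have "\<dots> \<le> capacity I k * ln 2 / gamma I k"
    using small k by (auto simp: small_demands_def)
  finally show ?thesis
    using gamma_pos[OF k] capacity_pos[OF k] by (simp add: field_simps)
qed

text \<open>The exponent of \<open>mu\<close> is at most \<open>ln 2\<close>, hence at most 1, where
  the exponential can be replaced by a linear bound.\<close>

lemma mu_minus_one_le: "capacity I k * (mu I n k - 1) \<le> 2 * gamma I k * demand I n k"
proof -
  let ?y = "demand I n k * gamma I k / capacity I k"
  have "ln 2 \<le> (1::real)"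
    using ln_le_minus_one[of "2::real"] by simp
  then have "exp ?y - 1 \<le> 2 * ?y"
    using demand_pos gamma_pos[OF k] capacity_pos[OF k]
    by (intro exp_minus_one_le order.trans[OF demand_gamma_le]) auto
  then have "capacity I k * (mu I n k - 1) \<le> capacity I k * (2 * ?y)"
    unfolding mu_def using capacity_pos[OF k] by (intro mult_left_mono) auto
  then show ?thesis
    using capacity_pos[OF k] by (simp add: field_simps)
qed

lemma mu_ge_1: "1 \<le> mu I n k"
  using demand_pos gamma_pos[OF k] capacity_pos[OF k] by (simp add: mu_def)

lemma beta_nonneg: "0 \<le> beta I n k"
  using mu_ge_1 theta_min_pos[OF k] by (simp add: beta_def)

text \<open>The lower bound serves the dual increase, the upper one feasibility. The density
  assumption constrains only requests of positive reward, hence the premise.\<close>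

lemma reward_bounds:
  assumes "0 < reward I n k"
  shows "theta_min I k * (demand I n k * real (duration I n k)) \<le> reward I n k"
    and "reward I n k \<le> demand I n k * (theta_max I k * d_max I k)"
proof -
  have pos: "0 < demand I n k * real (duration I n k)"
    using demand_pos duration_pos by simp
  have dens: "theta_min I k \<le> density I n k" "density I n k \<le> theta_max I k"
    using adm n k assms by (auto simp: admissible_def density_assumption_def requests_def)
  show "theta_min I k * (demand I n k * real (duration I n k)) \<le> reward I n k"
    using dens(1) pos by (simp add: density_def pos_le_divide_eq)
  have "reward I n k \<le> theta_max I k * (demand I n k * real (duration I n k))"
    using dens(2) pos by (simp add: density_def pos_divide_le_eq)
  also have "\<dots> = demand I n k * (theta_max I k * real (duration I n k))"
    by simp
  also have "\<dots> \<le> demand I n k * (theta_max I k * d_max I k)"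
    using demand_pos duration_le_d_max theta_min_pos[OF k] dens
    by (intro mult_left_mono) auto
  finally show "reward I n k \<le> demand I n k * (theta_max I k * d_max I k)" .
qed

end

section \<open>Invariants of a run: integrality, prices, acceptance\<close>

lemma run_sol_zero:
  "alg_run I n s \<Longrightarrow> n \<le> m \<or> k \<notin> resources I \<Longrightarrow> sol s m k = 0"
proof (induction arbitrary: m k rule: alg_run.induct)
  case init
  show ?case by (simp add: init_state_def)
next
  case (step n s s')
  from step.hyps(2) step.IH step.prems show ?case
    by cases (auto simp: assign_def best_resource_def is_arg_max_def)
qed

lemma run_sol_01: "alg_run I n s \<Longrightarrow> sol s m k \<in> {0, 1}"
proof (induction arbitrary: m k rule: alg_run.induct)
  case init
  show ?case by (simp add: init_state_def)
next
  case (step n s s')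
  from step.hyps(2) step.IH show ?case
    by cases (auto simp: assign_def)
qed

lemma run_sol_sum_le_1: "alg_run I n s \<Longrightarrow> (\<Sum>k\<in>resources I. sol s m k) \<le> 1"
proof (induction arbitrary: m rule: alg_run.induct)
  case init
  show ?case by (simp add: init_state_def)
next
  case (step n s s')
  note zero = run_sol_zero[OF step.hyps(1)]
  from step.hyps(2) show ?case
  proof cases
    case (accept j)
    have "sol s n = (\<lambda>k. 0)"
      using zero by auto
    then show ?thesis
      using step.IH finite_resources by (auto simp: accept assign_def sum.delta fun_upd_def)
  next
    case reject
    then show ?thesis using step.IH by simp
  qed
qed

text \<open>Price plus \<open>theta_min\<close> is proportional to the exponential of the load, so
  adding a demand multiplies this sum by \<open>mu\<close>; the choice of \<open>beta\<close> turns
  that into the update rule.\<close>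

lemma load_price_Suc:
  assumes "k \<in> resources I" "x n k = 1" "t \<in> active I n k"
  shows "load_price I x (Suc n) k t = mu I n k * load_price I x n k t + beta I n k"
proof -
  have "exp (gamma I k * load I x (Suc n) k t / capacity I k) =
      mu I n k * exp (gamma I k * load I x n k t / capacity I k)"
    using assms by (simp add: load_Suc mu_def exp_add[symmetric] add_divide_distrib algebra_simps)
  then show ?thesis
    by (simp add: load_price_def beta_def algebra_simps)
qed

lemma load_price_Suc_other:
  assumes "x n k = 0 \<or> t \<notin> active I n k"
  shows "load_price I x (Suc n) k t = load_price I x n k t"
  using assms by (auto simp: load_price_def load_Suc)

lemma load_price_cong:
  assumes "\<And>m. m < n \<Longrightarrow> x m k = y m k"
  shows "load_price I x n k t = load_price I y n k t"
  using load_cong[of n x k y I t] assms by (simp add: load_price_def)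

lemma run_price:
  "alg_run I n s \<Longrightarrow> price s k t = load_price I (sol s) n k t"
proof (induction arbitrary: k t rule: alg_run.induct)
  case init
  show ?case by (simp add: init_state_def load_price_def load_def)
next
  case (step n s s')
  note zero = run_sol_zero[OF step.hyps(1)]
  from step.hyps(2) show ?case
  proof cases
    case (accept j)
    have j: "j \<in> resources I"
      using accept by (simp add: best_resource_def is_arg_max_def)
    \<comment> \<open>Acceptance of \<open>n\<close> writes only row \<open>n\<close>, which a load
      of the first \<open>n\<close> requests does not read.\<close>
    have eq: "load_price I (sol s') n k t = load_price I (sol s) n k t"
      by (rule load_price_cong) (simp add: accept assign_def)
    show ?thesis
    proof (cases "k = j \<and> t \<in> active I n k")
      case True
      then have "sol s' n k = 1" "price s' k t = mu I n k * price s k t + beta I n k"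
        by (auto simp: accept assign_def)
      then show ?thesis
        using load_price_Suc[of k "sol s'" n t] True j eq step.IH by auto
    next
      case False
      then have "load_price I (sol s') (Suc n) k t = load_price I (sol s') n k t"
        using zero by (intro load_price_Suc_other) (auto simp: accept assign_def)
      moreover have "price s' k t = price s k t"
        using False by (auto simp: accept assign_def)
      ultimately show ?thesis
        using eq step.IH by simp
    qed
  next
    case reject
    then show ?thesis
      using step.IH zero load_price_Suc_other[of "sol s" n k t] by simp
  qed
qed

text \<open>The acceptance test that \<open>m\<close> passed on arrival, restated through the
  solution of any later state: the prices at that time depend only on rows below \<open>m\<close>,
  which no longer change.\<close>

lemma run_accepted:
  "alg_run I n s \<Longrightarrow> sol s m k = 1 \<Longrightarrow>
     demand I m k * (\<Sum>t\<in>active I m k. load_price I (sol s) m k t) < reward I m k"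
proof (induction arbitrary: m k rule: alg_run.induct)
  case init
  then show ?case by (simp add: init_state_def)
next
  case (step n s s')
  note zero = run_sol_zero[OF step.hyps(1)]
  from step.hyps(2) show ?case
  proof cases
    case (accept j)
    have eq: "load_price I (sol s') m k t = load_price I (sol s) m k t" if "m \<le> n" for t
      using that by (intro load_price_cong) (simp add: accept assign_def)
    show ?thesis
    proof (cases "m = n")
      case True
      then have "k = j"
        using step.prems zero[of n k] by (auto simp: accept assign_def split: if_splits)
      then show ?thesis
        using accept(3) eq True run_price[OF step.hyps(1)] by (simp add: cost_def)
    next
      case False
      then have "sol s m k = 1"
        using step.prems by (simp add: accept assign_def)
      moreover from this have "m \<le> n"
        using zero[of m k] by (cases "m \<le> n") auto
      ultimately show ?thesis
        using step.IH eq by simp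
    qed
  next
    case reject
    then show ?thesis using step.IH step.prems by simp
  qed
qed

section \<open>Capacity constraints\<close>

lemma load_nonneg:
  assumes "\<And>m. 0 \<le> x m k" "k \<in> resources I" "n \<le> num_requests I"
  shows "0 \<le> load I x n k t"
  unfolding load_def
  using assms demand_pos[OF _ assms(2)] by (intro sum_nonneg mult_nonneg_nonneg) (auto intro: less_imp_le)

lemma load_price_nonneg:
  assumes "\<And>m. 0 \<le> x m k" "k \<in> resources I" "n \<le> num_requests I"
  shows "0 \<le> load_price I x n k t"
  using load_nonneg[of x k n t] assms theta_min_pos[of k] gamma_pos[of k] capacity_pos[of k]
  by (simp add: load_price_def)

text \<open>\<open>B\<close> is one of the two kinds of requests and \<open>W\<close> their common
  window. The last arrival in \<open>B\<close> is the one to examine, since all others already count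
  in the load it saw.\<close>

lemma load_le_half_capacity_of_common_window:
  assumes run: "alg_run I (num_requests I) s" and k: "k \<in> resources I"
    and B: "finite B" "\<And>m. m \<in> B \<Longrightarrow> m < num_requests I \<and> sol s m k = 1"
    and window: "\<And>m. m \<in> B \<Longrightarrow> W \<subseteq> active I m k"
    and W: "d_min I k \<le> 2 * real (card W)"
  shows "(\<Sum>m\<in>B. demand I m k) \<le> capacity I k / 2"
proof (rule ccontr)
  assume "\<not> ?thesis"
  then have big: "capacity I k / 2 < (\<Sum>m\<in>B. demand I m k)" by simp
  then have "B \<noteq> {}"
    using capacity_pos[OF k] by auto
  define n where "n = Max B"
  have n: "n \<in> B" "\<And>m. m \<in> B \<Longrightarrow> m \<le> n"
    using B(1) \<open>B \<noteq> {}\<close> by (auto simp: n_def)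
  have nreq: "n < num_requests I" and xn: "sol s n k = 1"
    using B n by auto
  have x0: "0 \<le> sol s m k" for m
    using run_sol_01[OF run, of m k] by auto
  have price_ge: "2 * theta_max I k * d_bar I k \<le> load_price I (sol s) n k t" if t: "t \<in> W" for t
  proof -
    have "(\<Sum>m\<in>B - {n}. demand I m k) = (\<Sum>m\<in>B - {n}. demand I m k * sol s m k)"
      using B by (intro sum.cong) auto
    also have "\<dots> \<le> load I (sol s) n k t"
      unfolding load_def
    proof (rule sum_mono2)
      show "B - {n} \<subseteq> {m. m < n \<and> t \<in> active I m k}"
        using n window t by (auto simp: order.strict_iff_order)
      show "0 \<le> demand I b k * sol s b k"
        if "b \<in> {m. m < n \<and> t \<in> active I m k} - (B - {n})" for b
        using that nreq x0[of b] demand_pos[of b k] k by (simp add: less_imp_le)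
    qed simp
    finally have "capacity I k / 2 - demand I n k \<le> load I (sol s) n k t"
      using big B(1) n(1) by (simp add: sum_diff1)
    then have "gamma I k * (capacity I k / 2 - demand I n k) / capacity I k
        \<le> gamma I k * load I (sol s) n k t / capacity I k"
      using gamma_pos[OF k] capacity_pos[OF k] by (intro divide_right_mono mult_left_mono) auto
    moreover have "gamma I k * (capacity I k / 2 - demand I n k) / capacity I k =
        gamma I k / 2 - demand I n k * gamma I k / capacity I k"
      using capacity_pos[OF k] by (simp add: field_simps)
    ultimately have "gamma I k / 2 - ln 2 \<le> gamma I k * load I (sol s) n k t / capacity I k"
      using demand_gamma_le[OF nreq k] by linarith
    then have "exp (gamma I k / 2 - ln 2) \<le> exp (gamma I k * load I (sol s) n k t / capacity I k)"
      by simp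
    \<comment> \<open>Subtracting \<open>ln 2\<close> halves
      \<open>2 + 4 * theta_bar * d_bar\<close>, and the 1 that remains beside the product cancels
      against the \<open>- 1\<close> in the price.\<close>
    then have "2 * theta_bar I k * d_bar I k
        \<le> exp (gamma I k * load I (sol s) n k t / capacity I k) - 1"
      using exp_half_gamma[OF k] by (simp add: exp_diff)
    then have "theta_min I k * (2 * theta_bar I k * d_bar I k) \<le> load_price I (sol s) n k t"
      using theta_min_pos[OF k] by (simp add: load_price_def)
    then show ?thesis
      using theta_min_pos[OF k] by (simp add: theta_bar_def)
  qed
  have tm: "0 < theta_max I k"
    using adm k by (force simp: admissible_def density_assumption_def)
  have "theta_max I k * d_max I k = d_min I k * (theta_max I k * d_bar I k)"
    using d_min_pos[OF k] by (simp add: d_bar_def)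
  \<comment> \<open>The 2 in the price bound compensates for \<open>W\<close> having perhaps only
    half of \<open>d_min\<close> slots.\<close>
  also have "\<dots> \<le> 2 * real (card W) * (theta_max I k * d_bar I k)"
    using W tm d_bar_ge_1[OF k] by (intro mult_right_mono) auto
  also have "\<dots> = (\<Sum>t\<in>W. 2 * theta_max I k * d_bar I k)"
    by simp
  also have "\<dots> \<le> (\<Sum>t\<in>W. load_price I (sol s) n k t)"
    using price_ge by (intro sum_mono)
  also have "\<dots> \<le> (\<Sum>t\<in>active I n k. load_price I (sol s) n k t)"
    using window[OF n(1)] load_price_nonneg[of "sol s" k n] x0 k nreq
    by (intro sum_mono2) (auto simp: active_def)
  finally have "demand I n k * (theta_max I k * d_max I k)
      \<le> demand I n k * (\<Sum>t\<in>active I n k. load_price I (sol s) n k t)"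
    using demand_pos[OF nreq k] by simp
  also have "\<dots> < reward I n k"
    by (rule run_accepted[OF run xn])
  finally have lt: "demand I n k * (theta_max I k * d_max I k) < reward I n k" .
  \<comment> \<open>An accepted reward exceeds a nonnegative cost, so it is positive and the density
    bounds apply.\<close>
  have "0 \<le> demand I n k * (\<Sum>t\<in>active I n k. load_price I (sol s) n k t)"
    using demand_pos[OF nreq k] load_price_nonneg[of "sol s" k n] x0 k nreq
    by (intro mult_nonneg_nonneg sum_nonneg) auto
  then have "0 < reward I n k"
    using run_accepted[OF run xn] by linarith
  then show False
    using reward_bounds(2)[OF nreq k] lt by simp
qed

lemma run_load_le_capacity:
  assumes run: "alg_run I (num_requests I) s" and k: "k \<in> resources I"
  shows "load I (sol s) (num_requests I) k t \<le> capacity I k"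
proof -
  define h where "h = nat \<lceil>d_min I k / 2\<rceil>"
  have h: "d_min I k \<le> 2 * real h" "2 * real h < d_min I k + 2"
    using d_min_pos[OF k] by (auto simp: h_def) linarith+
  define A where "A = {m. m < num_requests I \<and> t \<in> active I m k \<and> sol s m k = 1}"
  \<comment> \<open>Members of \<open>L\<close> cover the \<open>h\<close> slots ending at
    \<open>t\<close>, those of \<open>R\<close> the \<open>h\<close> slots starting at
    \<open>t\<close>. Stating this with sums avoids truncated subtraction.\<close>
  define L where "L = {m \<in> A. start I m k + h \<le> t + 1}"
  define R where "R = {m \<in> A. t + h \<le> start I m k + duration I m k}"
  have fin: "finite A" "finite L" "finite R"
    by (auto simp: A_def L_def R_def)
  have "A \<subseteq> L \<union> R"
  proof
    fix m assume m: "m \<in> A"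
    then have "d_min I k \<le> real (duration I m k)"
      using d_min_le_duration k by (auto simp: A_def)
    \<comment> \<open>A request in neither set has \<open>t + 1 < start + h\<close> and
      \<open>start + duration < t + h\<close>; adding the two contradicts this bound.\<close>
    then have "2 * real h < real (duration I m k + 2)"
      using h by simp
    then have "2 * h < duration I m k + 2"
      by linarith
    with m show "m \<in> L \<union> R"
      by (auto simp: A_def L_def R_def active_def)
  qed
  have nonneg: "0 \<le> demand I m k" if "m \<in> A" for m
    using that demand_pos[of m k] k by (auto simp: A_def)
  have "load I (sol s) (num_requests I) k t = (\<Sum>m\<in>A. demand I m k)"
    unfolding load_def A_def
    using run_sol_01[OF run] by (intro sum.mono_neutral_cong_right) fastforce+
  also have "\<dots> \<le> (\<Sum>m\<in>L \<union> R. demand I m k)"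
    using \<open>A \<subseteq> L \<union> R\<close> fin nonneg by (intro sum_mono2) (auto simp: L_def R_def)
  also have "\<dots> \<le> (\<Sum>m\<in>L. demand I m k) + (\<Sum>m\<in>R. demand I m k)"
  proof -
    have "0 \<le> (\<Sum>m\<in>L \<inter> R. demand I m k)"
      using nonneg by (intro sum_nonneg) (auto simp: L_def)
    then show ?thesis
      using sum.union_inter[OF fin(2,3), of "\<lambda>m. demand I m k"] by linarith
  qed
  also have "(\<Sum>m\<in>L. demand I m k) \<le> capacity I k / 2"
  \<comment> \<open>For \<open>h > t + 1\<close> the left window would begin before slot 0, and no
    request can cover it.\<close>
  proof (cases "h \<le> t + 1")
    case True
    then show ?thesis
      using fin h
      by (intro load_le_half_capacity_of_common_window[OF run k, where W = "{t + 1 - h..<t + 1}"])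
        (auto simp: L_def A_def active_def)
  next
    case False
    then have "L = {}" by (auto simp: L_def)
    then show ?thesis using capacity_pos[OF k] by simp
  qed
  also have "(\<Sum>m\<in>R. demand I m k) \<le> capacity I k / 2"
    using fin h
    by (intro load_le_half_capacity_of_common_window[OF run k, where W = "{t..<t + h}"])
      (auto simp: R_def A_def active_def)
  finally show ?thesis by simp
qed

lemma run_feasible:
  assumes "alg_run I (num_requests I) s"
  shows "feasible I (sol s)"
  using run_sol_01[OF assms] run_sol_sum_le_1[OF assms] run_load_le_capacity[OF assms]
  by (auto simp: feasible_def load_def requests_def)

section \<open>The dual solution: feasibility and weak duality\<close>

lemma run_price_nonneg:
  assumes "alg_run I n s" "n \<le> num_requests I" "k \<in> resources I"
  shows "0 \<le> price s k t"
proof -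
  have "0 \<le> sol s m k" for m
    using run_sol_01[OF assms(1), of m k] by auto
  then show ?thesis
    using load_price_nonneg assms by (simp add: run_price)
qed

lemma run_util_nonneg: "alg_run I n s \<Longrightarrow> 0 \<le> util s m"
proof (induction arbitrary: m rule: alg_run.induct)
  case init
  show ?case by (simp add: init_state_def)
next
  case (step n s s')
  from step.hyps(2) step.IH show ?case
    by cases (auto simp: assign_def)
qed

lemma run_util_zero: "alg_run I n s \<Longrightarrow> n \<le> m \<Longrightarrow> util s m = 0"
proof (induction arbitrary: m rule: alg_run.induct)
  case init
  show ?case by (simp add: init_state_def)
next
  case (step n s s')
  from step.hyps(2) step.IH step.prems show ?case
    by cases (auto simp: assign_def)
qed

text \<open>Since \<open>mu\<close> is at least 1 and \<open>beta\<close> is nonnegative, updates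
  never lower a price; dual constraints therefore survive later arrivals.\<close>

lemma step_price_mono:
  assumes run: "alg_run I n s" and step: "alg_step I n s s'" and n: "n < num_requests I"
    and k: "k \<in> resources I"
  shows "price s k t \<le> price s' k t"
  using step
proof cases
  case (accept j)
  have "1 * price s k t \<le> mu I n k * price s k t"
    using mu_ge_1[OF n k] run_price_nonneg[OF run _ k] n by (intro mult_right_mono) auto
  then show ?thesis
    using accept beta_nonneg[OF n k] by (auto simp: assign_def)
qed simp

lemma run_dual_feasible:
  "alg_run I n s \<Longrightarrow> n \<le> num_requests I \<Longrightarrow> m < n \<Longrightarrow> k \<in> resources I \<Longrightarrow>
     reward I m k - cost I s m k \<le> util s m"
proof (induction arbitrary: m k rule: alg_run.induct)
  case init
  then show ?case by simp
next
  case (step n s s')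
  then have n: "n < num_requests I" by simp
  have "cost I s m k \<le> cost I s' m k"
    unfolding cost_def using demand_pos[of m k] step.prems n
    by (intro mult_left_mono sum_mono step_price_mono[OF step.hyps n]) auto
  moreover have "reward I m k - cost I s m k \<le> util s' m"
  proof (cases "m = n")
    case True
    from step.hyps(2) show ?thesis
    proof cases
      case (accept j)
      then have "reward I n k - cost I s n k \<le> reward I n j - cost I s n j"
        using step.prems by (auto simp: best_resource_def is_arg_max_def not_less)
      then show ?thesis using accept True by (simp add: assign_def)
    next
      case (reject j)
      then have "reward I n k - cost I s n k \<le> reward I n j - cost I s n j"
        using step.prems by (auto simp: best_resource_def is_arg_max_def not_less)
      \<comment> \<open>Rejection means that even the best surplus is at most 0, the initial value
        of \<open>util\<close>.\<close>
      then show ?thesis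
        using reject True run_util_zero[OF step.hyps(1), of n] by simp
    qed
  next
    case False
    with step.hyps(2) have "util s' m = util s m"
      by cases (auto simp: assign_def)
    then show ?thesis using step.IH[of m k] step.prems False by simp
  qed
  ultimately show ?case by linarith
qed

text \<open>Dual feasibility bounds each reward by utility plus cost. The utilities are then
  absorbed by the row sums of \<open>x\<close>, the costs slot by slot by the capacities.\<close>

lemma weak_duality:
  assumes run: "alg_run I (num_requests I) s" and x: "feasible I x"
  shows "sol_value I x \<le> dual_value I (num_requests I) s"
proof -
  let ?N = "{..<num_requests I}"
  have x01: "x n k \<in> {0, 1}" if "n \<in> ?N" "k \<in> resources I" for n k
    using x that unfolding feasible_def requests_def by blast
  have "sol_value I x \<le> (\<Sum>n\<in>?N. \<Sum>k\<in>resources I. (util s n + cost I s n k) * x n k)"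
    unfolding sol_value_def requests_def
  proof (intro sum_mono mult_right_mono)
    fix n k assume *: "n \<in> ?N" "k \<in> resources I"
    show "reward I n k \<le> util s n + cost I s n k"
      using run_dual_feasible[OF run, of n k] * by simp
    show "0 \<le> x n k"
      using x01[OF *] by auto
  qed
  also have "\<dots> = (\<Sum>n\<in>?N. util s n * (\<Sum>k\<in>resources I. x n k)) +
      (\<Sum>k\<in>resources I. \<Sum>n\<in>?N. cost I s n k * x n k)"
    by (subst (2) sum.swap) (simp add: distrib_right sum.distrib sum_distrib_left)
  also have "(\<Sum>n\<in>?N. util s n * (\<Sum>k\<in>resources I. x n k)) \<le> (\<Sum>n\<in>?N. util s n)"
    using x run_util_nonneg[OF run]
    by (intro sum_mono mult_left_le) (auto simp: feasible_def requests_def)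
  also have "(\<Sum>k\<in>resources I. \<Sum>n\<in>?N. cost I s n k * x n k)
      \<le> (\<Sum>k\<in>resources I. \<Sum>t\<in>slots I. capacity I k * price s k t)"
  proof (intro sum_mono)
    fix k assume k: "k \<in> resources I"
    \<comment> \<open>Extending each sum from the active slots to all slots makes its range
      independent of \<open>n\<close>, so that the two sums can be swapped.\<close>
    have "(\<Sum>n\<in>?N. cost I s n k * x n k) =
        (\<Sum>n\<in>?N. \<Sum>t\<in>slots I. if t \<in> active I n k then demand I n k * x n k * price s k t else 0)"
    proof (intro sum.cong refl)
      fix n assume n: "n \<in> ?N"
      have "(\<Sum>t\<in>active I n k. price s k t) =
          (\<Sum>t\<in>slots I. if t \<in> active I n k then price s k t else 0)"
        using active_slots[of n k] n k finite_slots
        by (intro sum.mono_neutral_cong_left) auto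
      then show "cost I s n k * x n k = (\<Sum>t\<in>slots I.
          if t \<in> active I n k then demand I n k * x n k * price s k t else 0)"
        by (auto simp: cost_def sum_distrib_left sum_distrib_right intro!: sum.cong)
    qed
    also have "\<dots> = (\<Sum>t\<in>slots I. \<Sum>n\<in>?N.
        if t \<in> active I n k then demand I n k * x n k * price s k t else 0)"
      by (rule sum.swap)
    also have "\<dots> = (\<Sum>t\<in>slots I.
        (\<Sum>n | n \<in> requests I \<and> t \<in> active I n k. demand I n k * x n k) * price s k t)"
      by (intro sum.cong refl)
        (auto simp: requests_def sum_distrib_right split: if_splits
          intro!: sum.mono_neutral_cong_right)
    also have "\<dots> \<le> (\<Sum>t\<in>slots I. capacity I k * price s k t)"
      using x k run_price_nonneg[OF run _ k]
      by (intro sum_mono mult_right_mono) (auto simp: feasible_def)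
    finally show "(\<Sum>n\<in>?N. cost I s n k * x n k) \<le> (\<Sum>t\<in>slots I. capacity I k * price s k t)" .
  qed
  finally show ?thesis by (simp add: dual_value_def)
qed

section \<open>Growth of the dual value against the primal value\<close>

lemma step_dual_increase:
  assumes run: "alg_run I n s" and n: "n < num_requests I" and k: "k \<in> resources I"
    and acc: "cost I s n k < reward I n k"
  shows "dual_value I (Suc n) (assign I n k s) - dual_value I n s
      \<le> (1 + 4 * gamma I k) * reward I n k"
proof -
  let ?s = "assign I n k s" and ?T = "active I n k"
  have T: "?T \<subseteq> slots I" "finite ?T" "card ?T = duration I n k"
    using active_slots[OF n k] by (auto simp: active_def)
  have cost_nonneg: "0 \<le> cost I s n k"
    using run_price_nonneg[OF run _ k] n demand_pos[OF n k]
    by (auto simp: cost_def intro!: mult_nonneg_nonneg sum_nonneg)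
  have "(\<Sum>j\<in>resources I. \<Sum>t\<in>slots I. capacity I j * price ?s j t)
      - (\<Sum>j\<in>resources I. \<Sum>t\<in>slots I. capacity I j * price s j t)
      = (\<Sum>j\<in>resources I. \<Sum>t\<in>slots I. capacity I j * (price ?s j t - price s j t))"
    by (simp add: sum_subtractf right_diff_distrib)
  also have "\<dots> = (\<Sum>t\<in>slots I. capacity I k * (price ?s k t - price s k t))"
    using finite_resources k
    by (subst sum.remove[where x = k]) (auto simp: assign_def)
  also have "\<dots> = (\<Sum>t\<in>?T. capacity I k * ((mu I n k - 1) * (price s k t + theta_min I k)))"
    using T finite_slots
    by (intro sum.mono_neutral_cong_right) (auto simp: assign_def beta_def algebra_simps)
  also have "\<dots> = capacity I k * (mu I n k - 1) *
      ((\<Sum>t\<in>?T. price s k t) + real (duration I n k) * theta_min I k)"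
    by (simp add: sum_distrib_left[symmetric] sum.distrib T mult.assoc)
  also have "\<dots> \<le> 2 * gamma I k * demand I n k *
      ((\<Sum>t\<in>?T. price s k t) + real (duration I n k) * theta_min I k)"
    using mu_minus_one_le[OF n k] run_price_nonneg[OF run _ k] n theta_min_pos[OF k]
    by (intro mult_right_mono add_nonneg_nonneg sum_nonneg) auto
  also have "\<dots> = 2 * gamma I k *
      (cost I s n k + theta_min I k * (demand I n k * real (duration I n k)))"
    by (simp add: cost_def algebra_simps)
  \<comment> \<open>The cost is below the reward by acceptance, the other term by the lower density
    bound. With the 2 from linearising \<open>mu\<close> this gives the 4.\<close>
  also have "\<dots> \<le> 2 * gamma I k * (reward I n k + reward I n k)"
  proof -
    have "theta_min I k * (demand I n k * real (duration I n k)) \<le> reward I n k"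
      using acc cost_nonneg by (intro reward_bounds[OF n k]) auto
    then show ?thesis
      using acc gamma_pos[OF k] by (intro mult_left_mono add_mono) auto
  qed
  finally have prices: "(\<Sum>j\<in>resources I. \<Sum>t\<in>slots I. capacity I j * price ?s j t)
      - (\<Sum>j\<in>resources I. \<Sum>t\<in>slots I. capacity I j * price s j t) \<le> 4 * gamma I k * reward I n k"
    by simp
  have "(\<Sum>m<Suc n. util ?s m) - (\<Sum>m<n. util s m) \<le> reward I n k"
    using cost_nonneg by (simp add: assign_def)
  with prices show ?thesis
    by (simp add: dual_value_def algebra_simps)
qed

text \<open>Sums the increases over the run; \<open>G\<close> bounds \<open>gamma\<close> on all
  resources at once, so one factor serves every acceptance.\<close>

lemma run_dual_le_primal:
  assumes G: "\<And>k. k \<in> resources I \<Longrightarrow> gamma I k \<le> G"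
  shows "alg_run I n s \<Longrightarrow> n \<le> num_requests I \<Longrightarrow>
     dual_value I n s \<le> (1 + 4 * G) * (\<Sum>m<n. \<Sum>k\<in>resources I. reward I m k * sol s m k)"
proof (induction rule: alg_run.induct)
  case init
  show ?case by (simp add: dual_value_def init_state_def)
next
  case (step n s s')
  then have n: "n < num_requests I" by simp
  note IH = step.IH[OF less_imp_le[OF n]]
  have zero: "sol s n = (\<lambda>k. 0)"
    using run_sol_zero[OF step.hyps(1)] by auto
  from step.hyps(2) show ?case
  proof cases
    case (accept j)
    then have j: "j \<in> resources I"
      by (simp add: best_resource_def is_arg_max_def)
    have "dual_value I (Suc n) s' \<le> dual_value I n s + (1 + 4 * gamma I j) * reward I n j"
      using step_dual_increase[OF step.hyps(1) n j accept(3)] accept(1) by simp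
    also have "\<dots> \<le> dual_value I n s + (1 + 4 * G) * reward I n j"
      using G[OF j] reward_nonneg[OF n j] by (intro add_left_mono mult_right_mono) auto
    also have "\<dots> \<le> (1 + 4 * G) * ((\<Sum>m<n. \<Sum>k\<in>resources I. reward I m k * sol s m k) + reward I n j)"
      using IH by (simp add: distrib_left)
    also have "(\<Sum>m<n. \<Sum>k\<in>resources I. reward I m k * sol s m k) =
        (\<Sum>m<n. \<Sum>k\<in>resources I. reward I m k * sol s' m k)"
      by (simp add: accept assign_def)
    also have "reward I n j = (\<Sum>k\<in>resources I. reward I n k * sol s' n k)"
      using j finite_resources zero
      by (subst sum.remove[where x = j]) (auto simp: accept assign_def)
    finally show ?thesis by simp
  next
    case reject
    then show ?thesis
      using IH zero run_util_zero[OF step.hyps(1), of n] by (simp add: dual_value_def)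
  qed
qed

lemma gamma_le_max:
  assumes k: "k \<in> resources I"
  shows "gamma I k \<le> 2 * ln (2 + 4 * (theta_bar_max I * d_bar_max I))"
proof -
  have "theta_bar I k * d_bar I k \<le> theta_bar_max I * d_bar_max I"
  proof (rule mult_mono)
    show le: "theta_bar I k \<le> theta_bar_max I" and "d_bar I k \<le> d_bar_max I"
      using k finite_resources by (auto simp: theta_bar_max_def d_bar_max_def)
    show "0 \<le> theta_bar_max I" "0 \<le> d_bar I k"
      using le theta_bar_ge_1[OF k] d_bar_ge_1[OF k] by auto
  qed
  moreover have "0 \<le> theta_bar I k * d_bar I k"
    using theta_bar_ge_1[OF k] d_bar_ge_1[OF k] by simp
  ultimately show ?thesis
    by (simp add: gamma_def mult.assoc)
qed

lemma run_competitive: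
  assumes run: "alg_run I (num_requests I) s"
  shows "opt_value I \<le> (1 + 8 * ln (2 + 4 * (theta_bar_max I * d_bar_max I))) * sol_value I (sol s)"
proof -
  have wf: "well_formed I"
    using adm by (simp add: admissible_def)
  have "opt_value I \<le> dual_value I (num_requests I) s"
    unfolding opt_value_def
    using finite_feasible_values[OF wf] feasible_zero[OF wf] weak_duality[OF run]
    by (subst Max_le_iff) auto
  \<comment> \<open>The 8 is the factor 4 of the dual increase times the 2 in
    \<open>gamma\<close>.\<close>
  also have "\<dots> \<le> (1 + 8 * ln (2 + 4 * (theta_bar_max I * d_bar_max I))) * sol_value I (sol s)"
    using run_dual_le_primal[OF gamma_le_max run]
    by (simp add: sol_value_def requests_def)
  finally show ?thesis .
qed

end

section \<open>Asymptotics of the ratio and conclusion\<close>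

lemma one_plus_ln_bigo: "(\<lambda>r::real. 1 + 8 * ln (2 + 4 * r)) \<in> O[at_top](\<lambda>r. ln r)"
proof (rule bigoI)
  \<comment> \<open>From 5 on, \<open>2 + 4 * r\<close> is at most \<open>r * r\<close> and
    \<open>ln r\<close> is at least 1, so the ratio is at most
    \<open>ln r + 16 * ln r\<close>.\<close>
  show "\<forall>\<^sub>F r in at_top. norm (1 + 8 * ln (2 + 4 * r)) \<le> 17 * norm (ln (r::real))"
    using eventually_ge_at_top[of "5::real"]
  proof eventually_elim
    case (elim r)
    have "ln (2 + 4 * r) \<le> ln (r * r)"
    proof -
      have "5 * r \<le> r * r"
        using elim by (intro mult_right_mono) auto
      then have "2 + 4 * r \<le> r * r"
        using elim by linarith
      then show ?thesis
        using elim by (intro ln_mono) auto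
    qed
    moreover have "ln (r * r) = 2 * ln r"
      using elim by (simp add: ln_mult)
    moreover have "1 \<le> ln r"
      using elim exp_le by (subst ln_ge_iff) auto
    moreover have "0 \<le> ln (2 + 4 * r)"
      using elim by simp
    ultimately show ?case by simp
  qed
qed

theorem theorem1:
  shows "(\<forall>(I :: 'k omkd) x. admissible I \<and> small_demands I \<longrightarrow> alg_output I x \<longrightarrow> feasible I x) \<and>
         (\<exists>\<alpha> :: real \<Rightarrow> real. \<alpha> \<in> O[at_top](\<lambda>r. ln r) \<and>
            has_competitive_ratio (\<lambda>I :: 'k omkd. admissible I \<and> small_demands I)
              (\<lambda>I. \<alpha> (theta_bar_max I * d_bar_max I)))"
proof (intro conjI exI[of _ "\<lambda>r. 1 + 8 * ln (2 + 4 * r)"])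
  show "\<forall>(I :: 'k omkd) x. admissible I \<and> small_demands I \<longrightarrow> alg_output I x \<longrightarrow> feasible I x"
    by (auto simp: alg_output_def
        intro: small_demand_instance.run_feasible small_demand_instance.intro)
  show "has_competitive_ratio (\<lambda>I :: 'k omkd. admissible I \<and> small_demands I)
      (\<lambda>I. 1 + 8 * ln (2 + 4 * (theta_bar_max I * d_bar_max I)))"
    by (auto simp: has_competitive_ratio_def alg_output_def
        intro!: small_demand_instance.run_competitive small_demand_instance.intro)
qed (rule one_plus_ln_bigo)

end
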